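(* Let $k$ and $n$ be integers with $k\geq 3$ and $n\geq k+2$. If $G$ is a connected $k$-regular graph of order $n$, then $$C(G)\leq 1-\frac{6}{k(k+1)},$$ with equality if and only if $n/(k+1)$ is an integer and $G$ is isomorphic to $G(k,n/(k+1))$.
   Context: All graphs are finite and simple. For a vertex $u$ of a graph $G$, $N_G(u)$ is its neighborhood, $d_G(u)$ its degree, and $m(G[N_G(u)])$ the number of edges of the subgraph induced by $N_G(u)$. The clustering coefficient of $u$ in $G$ is $C_u(G)=m(G[N_G(u)])/\binom{d_G(u)}{2}$ if $d_G(u)\geq 2$, and $C_u(G)=0$ otherwise. The clustering coefficient of $G$ is $C(G)=\frac{1}{n(G)}\sum_{u\in V(G)}C_u(G)$, where $n(G)$ is the order of $G$. For integers $k\geq 3$ and $\ell\geq 2$, $G(k,\ell)$ denotes the $k$-regular connected graph obtained from $\ell$ disjoint copies $G_1,\ldots,G_\ell$ of $K_{k+1}-e$ (the complete graph on $k+1$ vertices minus one edge) by adding, for every $i\in\{1,\ldots,\ell\}$, an edge between a vertex of $G_i$ and a vertex of $G_{i+1}$ (indices modulo $\ell$), chosen so that the resulting graph is $k$-regular; i.e., each of the two vertices of degree $k-1$ in each $G_i$ receives exactly one new edge, one going to $G_{i-1}$ and one to $G_{i+1}$. This graph is unique up to isomorphism. *)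

theory Defs
  imports Complex_Main
begin

text \<open>A finite simple graph: finite vertex set V and a set E of edges,
each edge being a 2-element subset of V.\<close>
definition simple_graph :: "'a set \<Rightarrow> 'a set set \<Rightarrow> bool" where
  "simple_graph V E \<longleftrightarrow> finite V \<and> (\<forall>e\<in>E. \<exists>u v. e = {u, v} \<and> u \<in> V \<and> v \<in> V \<and> u \<noteq> v)"

definition neighbors :: "'a set \<Rightarrow> 'a set set \<Rightarrow> 'a \<Rightarrow> 'a set" where
  "neighbors V E u = {v \<in> V. {u, v} \<in> E}"

definition degree :: "'a set \<Rightarrow> 'a set set \<Rightarrow> 'a \<Rightarrow> nat" where
  "degree V E u = card (neighbors V E u)"

text \<open>number of edges of the subgraph induced by a vertex set S\<close>
definition induced_edges :: "'a set set \<Rightarrow> 'a set \<Rightarrow> nat" where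
  "induced_edges E S = card {e \<in> E. e \<subseteq> S}"

definition local_clustering :: "'a set \<Rightarrow> 'a set set \<Rightarrow> 'a \<Rightarrow> real" where
  "local_clustering V E u =
     (if degree V E u \<ge> 2
      then real (induced_edges E (neighbors V E u)) / real (degree V E u choose 2)
      else 0)"

definition clustering :: "'a set \<Rightarrow> 'a set set \<Rightarrow> real" where
  "clustering V E = (\<Sum>u\<in>V. local_clustering V E u) / real (card V)"

definition regular :: "'a set \<Rightarrow> 'a set set \<Rightarrow> nat \<Rightarrow> bool" where
  "regular V E k \<longleftrightarrow> (\<forall>u\<in>V. degree V E u = k)"

definition connected_graph :: "'a set \<Rightarrow> 'a set set \<Rightarrow> bool" where
  "connected_graph V E \<longleftrightarrow>
     (\<forall>u\<in>V. \<forall>v\<in>V. (u, v) \<in> {(x, y). x \<in> V \<and> y \<in> V \<and> {x, y} \<in> E}\<^sup>*)"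

definition graph_iso :: "'a set \<Rightarrow> 'a set set \<Rightarrow> 'b set \<Rightarrow> 'b set set \<Rightarrow> bool" where
  "graph_iso V E V' E' \<longleftrightarrow>
     (\<exists>f. bij_betw f V V' \<and> (\<forall>u\<in>V. \<forall>v\<in>V. {u, v} \<in> E \<longleftrightarrow> {f u, f v} \<in> E'))"

text \<open>The graph G(k,l): copies i < l, each with vertices (i,0),...,(i,k) forming
K_{k+1} minus the edge {(i,0),(i,1)}; plus the edges {(i,1),((i+1) mod l, 0)}.\<close>
definition Gkl_V :: "nat \<Rightarrow> nat \<Rightarrow> (nat \<times> nat) set" where
  "Gkl_V k l = {0..<l} \<times> {0..k}"

definition Gkl_E :: "nat \<Rightarrow> nat \<Rightarrow> (nat \<times> nat) set set" where
  "Gkl_E k l =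
     {{(i, a), (i, b)} | i a b. i < l \<and> a \<le> k \<and> b \<le> k \<and> a \<noteq> b \<and> {a, b} \<noteq> {0, 1}}
     \<union> {{(i, 1), ((i + 1) mod l, 0)} | i. i < l}"

end

theory Submission
  imports Defs
begin

text \<open>
  Let the defect of a vertex be the number of non-adjacent pairs of its neighbours. The bound
  says that the average defect is at least \<open>\<mu> = 3(k-1)/(k+1)\<close>. Connectedness and
  \<open>n \<ge> k + 2\<close> make every defect positive. If \<open>u\<close> has defect 1, then its closed
  neighbourhood is a copy of \<open>K\<^bsub>k+1\<^esub> - e\<close> (a block) whose two ends have defect \<open>k - 1\<close>
  and whose other vertices have defect 1, so the average over a block is exactly \<open>\<mu>\<close>.
  If \<open>u\<close> has defect 2, then at least three of its neighbours have defect at least \<open>k - 2\<close>.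
  A discharging along edges then brings every vertex of a block to exactly \<open>\<mu>\<close> and every
  other vertex strictly above \<open>\<mu>\<close>. Hence equality means that the blocks cover the graph;
  following alternately the non-edge inside a block and the edge leaving it arranges the blocks
  in a cycle, which exhausts the graph by connectedness.
\<close>

section \<open>Walks alternating between two involutions\<close>

text \<open>Later \<open>p\<close> passes to the other end of a block and \<open>q\<close> crosses
  the edge leaving it. The composite is injective on the finite set \<open>P\<close>, so the walk
  from \<open>x0\<close> closes up. The last property says that the walk enters every block it meets
  always by the same end.\<close>

lemma two_involutions_cycle:
  fixes p q :: "'a \<Rightarrow> 'a"
  assumes fin: "finite P" and x0: "x0 \<in> P"
    and p: "\<And>x. x \<in> P \<Longrightarrow> p x \<in> P" "\<And>x. x \<in> P \<Longrightarrow> p (p x) = x" "\<And>x. x \<in> P \<Longrightarrow> p x \<noteq> x"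
    and q: "\<And>x. x \<in> P \<Longrightarrow> q x \<in> P" "\<And>x. x \<in> P \<Longrightarrow> q (q x) = x" "\<And>x. x \<in> P \<Longrightarrow> q x \<noteq> x"
  obtains x :: "nat \<Rightarrow> 'a" and r where "0 < r" "\<And>i. x i \<in> P"
    "\<And>i. i < r \<Longrightarrow> q (p (x i)) = x (Suc i mod r)" "inj_on x {..<r}" "\<And>i j. p (x i) \<noteq> x j"
proof -
  define x where "x i = ((q \<circ> p) ^^ i) x0" for i
  have Suc: "x (Suc i) = q (p (x i))" for i by (simp add: x_def)
  have P: "x i \<in> P" for i
    by (induction i) (use x0 p q in \<open>simp_all add: Suc x_def[of 0]\<close>)
  have pred_eq: "x i = x j" if "x (Suc i) = x (Suc j)" for i j
    using that P p(1,2) q(2) unfolding Suc by metis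
  \<comment> \<open>Stepping backwards moves any repetition to the start, so the walk is periodic
    from \<open>x 0\<close> on.\<close>
  have shift: "x 0 = x d" if "x i = x (i + d)" for i d
    using that
  proof (induction i)
    case (Suc i)
    then show ?case using pred_eq[of i "i + d"] by simp
  qed simp
  have "finite (range x)" using fin by (rule rev_finite_subset) (use P in auto)
  then have "\<not> inj x" using finite_imageD by blast
  then obtain i j where "i \<noteq> j" "x i = x j" by (auto simp: inj_def)
  then obtain i j where "i < j" "x i = x j" by (cases i j rule: linorder_cases) auto
  then have "0 < j - i \<and> x (j - i) = x 0"
    using shift[of i "j - i"] by simp
  then have ex: "\<exists>r. 0 < r \<and> x r = x 0" by blast
  define r where "r = (LEAST r. 0 < r \<and> x r = x 0)"
  have r: "0 < r" "x r = x 0" using LeastI_ex[OF ex] by (auto simp: r_def)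
  have least: "x d \<noteq> x 0" if "0 < d" "d < r" for d
    using not_less_Least[of d "\<lambda>r. 0 < r \<and> x r = x 0"] that by (auto simp: r_def)
  have neq: "x i \<noteq> x j" if "i < j" "j < r" for i j
    using shift[of i "j - i"] least[of "j - i"] that less_imp_diff_less[of j r i] by auto
  have inj: "inj_on x {..<r}"
    by (rule inj_onI) (metis neq lessThan_iff linorder_neqE_nat)
  \<comment> \<open>If the walk met the partner of one of its own points, it would fold up towards the middle
    of the segment in between, giving a fixed point of p or of q.\<close>
  have fold: "p (x (i + d)) \<noteq> x i" for i d
  proof (induction d arbitrary: i rule: less_induct)
    case (less d)
    show ?case
    proof
      assume eq: "p (x (i + d)) = x i"
      consider "d = 0" | "d = 1" | e where "d = Suc (Suc e)"
        by (metis One_nat_def not0_implies_Suc)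
      then show False
      proof cases
        case 1
        then show False using eq p(3) P by simp
      next
        case 2
        then have "p (x i) = x (Suc i)" using eq p(2) P by (metis Suc_eq_plus1)
        then show False using Suc[of i] q(3) P by metis
      next
        case 3
        have "p (x i) = x (Suc (Suc (i + e)))" using eq p(2) P 3 by (metis add_Suc_right)
        then have "x (Suc i) = q (x (Suc (Suc (i + e))))" by (simp add: Suc)
        also have "\<dots> = p (x (Suc i + e))"
          using q(2) p(1) P Suc[of "Suc (i + e)"] by (metis add_Suc)
        finally show False using less[of e "Suc i"] 3 by simp
      qed
    qed
  qed
  have "p (x i) \<noteq> x j" for i j
  proof (cases "i \<le> j")
    case True
    then show ?thesis using fold[of i "j - i"] p(2) P by (metis le_add_diff_inverse)
  next
    case False
    then show ?thesis using fold[of j "i - j"] by simp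
  qed
  moreover have "q (p (x i)) = x (Suc i mod r)" if "i < r" for i
    using that r Suc[of i] by (cases "Suc i = r") auto
  ultimately show thesis using that r(1) P inj by blast
qed

section \<open>Isomorphisms onto the extremal graph\<close>

text \<open>The natural map to construct labels the vertices of \<open>V\<close> by pairs
  \<open>(i, a)\<close>; \<open>graph_iso\<close> asks for its inverse.\<close>

lemma graph_iso_inv:
  assumes g: "bij_betw g V' V" and adj: "\<And>s t. \<lbrakk>s \<in> V'; t \<in> V'\<rbrakk> \<Longrightarrow> {g s, g t} \<in> E \<longleftrightarrow> {s, t} \<in> E'"
  shows "graph_iso V E V' E'"
  unfolding graph_iso_def
proof (intro exI conjI ballI)
  show "bij_betw (inv_into V' g) V V'" by (rule bij_betw_inv_into[OF g])
  fix u v assume "u \<in> V" "v \<in> V"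
  then show "{u, v} \<in> E \<longleftrightarrow> {inv_into V' g u, inv_into V' g v} \<in> E'"
    using g adj[of "inv_into V' g u" "inv_into V' g v"]
    by (metis bij_betw_imp_surj_on f_inv_into_f inv_into_into)
qed

lemma Gkl_E_iff:
  assumes "i < l" "j < l" "a \<le> k" "b \<le> k"
  shows "{(i, a), (j, b)} \<in> Gkl_E k l \<longleftrightarrow>
    i = j \<and> a \<noteq> b \<and> {a, b} \<noteq> {0, 1} \<or> a = 1 \<and> b = 0 \<and> j = Suc i mod l \<or> a = 0 \<and> b = 1 \<and> i = Suc j mod l"
  using assms by (auto simp: Gkl_E_def doubleton_eq_iff)

section \<open>Defects in regular graphs\<close>

locale regular_graph =
  fixes V :: "'a set" and E :: "'a set set" and k :: nat
  assumes simple: "simple_graph V E" and reg: "regular V E k" and k3: "3 \<le> k"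
begin

abbreviation N :: "'a \<Rightarrow> 'a set" where "N \<equiv> neighbors V E"

abbreviation Nc :: "'a \<Rightarrow> 'a set" where "Nc u \<equiv> insert u (N u)"

definition gaps :: "'a \<Rightarrow> 'a set set" where
  "gaps u = {e. e \<subseteq> N u \<and> card e = 2 \<and> e \<notin> E}"

abbreviation defect :: "'a \<Rightarrow> nat" where "defect u \<equiv> card (gaps u)"

lemma finite_V: "finite V"
  using simple by (simp add: simple_graph_def)

lemma N_subset: "N u \<subseteq> V"
  by (auto simp: neighbors_def)

lemma finite_N [simp]: "finite (N u)"
  using finite_V N_subset finite_subset by blast

lemma card_N: "u \<in> V \<Longrightarrow> card (N u) = k"
  using reg by (simp add: regular_def degree_def)

lemma not_in_N [simp]: "u \<notin> N u"
  using simple by (fastforce simp: neighbors_def simple_graph_def)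

lemma card_Nc: "u \<in> V \<Longrightarrow> card (Nc u) = k + 1"
  by (simp add: card_N)

lemma edge_iff_N: "v \<in> V \<Longrightarrow> {u, v} \<in> E \<longleftrightarrow> v \<in> N u"
  by (simp add: neighbors_def)

lemma N_sym: "u \<in> V \<Longrightarrow> v \<in> N u \<Longrightarrow> u \<in> N v"
  by (simp add: neighbors_def insert_commute)

lemma edge_card: "e \<in> E \<Longrightarrow> card e = 2"
  using simple by (fastforce simp: simple_graph_def)

lemma finite_gaps [simp]: "finite (gaps u)"
  by (rule finite_subset[of _ "Pow (N u)"]) (auto simp: gaps_def)

text \<open>The \<open>k choose 2\<close> pairs of neighbours split into edges and gaps.\<close>

lemma local_clustering_defect:
  assumes "u \<in> V"
  shows "local_clustering V E u = 1 - real (defect u) / real (k choose 2)"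
proof -
  let ?S = "{e. e \<subseteq> N u \<and> card e = 2}" and ?I = "{e \<in> E. e \<subseteq> N u}"
  have "?S = ?I \<union> gaps u" "?I \<inter> gaps u = {}"
    using edge_card by (auto simp: gaps_def)
  moreover have "finite ?I"
    by (rule finite_subset[of _ "Pow (N u)"]) auto
  ultimately have "card ?S = card ?I + defect u"
    by (simp add: card_Un_disjoint)
  moreover have "card ?S = k choose 2"
    using n_subsets[of "N u" 2] by (simp add: card_N assms)
  ultimately have eq: "real (k choose 2) = real (induced_edges E (N u)) + real (defect u)"
    by (simp add: induced_edges_def)
  have "real (k choose 2) > 0"
    using k3 by simp
  then show ?thesis
    using k3 assms eq by (simp add: local_clustering_def degree_def card_N field_simps)
qed

text \<open>No non-edge inside \<open>Nc u\<close> contains \<open>u\<close>. Hence vertices with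
  equal closed neighbourhoods (twins) have the same gaps.\<close>

lemma gaps_eq_Nc: "gaps u = {e. e \<subseteq> Nc u \<and> card e = 2 \<and> e \<notin> E}"
proof -
  have "u \<notin> e" if "e \<subseteq> Nc u" "card e = 2" "e \<notin> E" for e
  proof
    assume "u \<in> e"
    then obtain b where "e = {u, b}" "b \<noteq> u"
      using \<open>card e = 2\<close> by (auto simp: card_2_iff)
    with that show False
      by (auto simp: neighbors_def)
  qed
  then show ?thesis
    by (auto simp: gaps_def)
qed

lemma gapsE:
  assumes "e \<in> gaps u" "x \<in> e"
  obtains y where "e = {x, y}" "x \<noteq> y" "x \<in> N u" "y \<in> N u" "y \<notin> N x" "x \<in> V" "y \<in> V"
proof -
  from assms obtain y where "e = {x, y}" "x \<noteq> y"
    by (auto simp: gaps_def card_2_iff)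
  with assms show thesis
    by (intro that) (auto simp: gaps_def neighbors_def)
qed

lemma gapsI: "\<lbrakk>x \<in> N u; y \<in> N u; x \<noteq> y; y \<notin> N x\<rbrakk> \<Longrightarrow> {x, y} \<in> gaps u"
  by (auto simp: gaps_def neighbors_def)

lemma Union_gaps_subset: "\<Union>(gaps u) \<subseteq> N u"
  by (auto simp: gaps_def)

text \<open>Such a vertex \<open>c\<close> is adjacent to everything else in \<open>Nc u\<close>,
  and regularity gives both closed neighbourhoods the same size. So \<open>c\<close> is a twin of
  \<open>u\<close>.\<close>

lemma Nc_eq_if_not_in_gap:
  assumes u: "u \<in> V" and c: "c \<in> Nc u" "c \<notin> \<Union>(gaps u)"
  shows "Nc c = Nc u"
proof (cases "c = u")
  case False
  have cV: "c \<in> V" using c False N_subset by auto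
  have "Nc u \<subseteq> Nc c"
  proof
    fix b assume b: "b \<in> Nc u"
    show "b \<in> Nc c"
      using gapsI[of c u b] N_sym[OF u, of c] b c False by auto
  qed
  then show ?thesis
    using card_subset_eq[of "Nc c" "Nc u"] card_Nc[OF u] card_Nc[OF cV] by simp
qed simp

text \<open>Inside \<open>Nc u\<close> the vertex \<open>w\<close> misses itself and its partner in
  the gap, which leaves room for at most \<open>k - 1\<close> neighbours.\<close>

lemma gap_outside_neighbor:
  assumes "{w, y} \<in> gaps u" "u \<in> V"
  obtains w' where "w' \<in> N w" "w' \<notin> Nc u"
proof -
  obtain y' where y': "w \<noteq> y'" "w \<in> N u" "y' \<in> N u" "y' \<notin> N w" "w \<in> V"
    by (rule gapsE[OF assms(1), of w]) auto
  have False if "N w \<subseteq> Nc u"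
  proof -
    have "N w \<subseteq> Nc u - {w, y'}" using that y' by auto
    then have "card (N w) \<le> card (Nc u - {w, y'})" by (intro card_mono) auto
    also have "\<dots> = k + 1 - 2"
      using y' card_Nc[OF assms(2)] by (subst card_Diff_subset) auto
    finally show False using card_N[OF y'(5)] k3 by simp
  qed
  then show thesis using that by blast
qed

text \<open>Let \<open>w'\<close> be a neighbour of \<open>w\<close> outside \<open>Nc u\<close>.
  Each twin \<open>c\<close> of \<open>u\<close> is adjacent to \<open>w\<close> but not to
  \<open>w'\<close>, so \<open>{w', c}\<close> is a gap at \<open>w\<close>. A gap \<open>f\<close>
  disjoint from all the others lies inside \<open>N w\<close> and contributes one more.\<close>

lemma defect_gap_vertex:
  assumes g: "e \<in> gaps u" "w \<in> e" and u: "u \<in> V"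
  shows "k + 1 \<le> card (\<Union>(gaps u)) + defect w"
    and "\<lbrakk>f \<in> gaps u; \<Union>(gaps u - {f}) \<inter> f = {}; e \<noteq> f\<rbrakk>
      \<Longrightarrow> k + 2 \<le> card (\<Union>(gaps u)) + defect w"
proof -
  obtain y where y: "e = {w, y}" "w \<noteq> y" "w \<in> N u" "y \<in> N u" "y \<notin> N w" "w \<in> V"
    using gapsE[OF g] by metis
  obtain w' where w': "w' \<in> N w" "w' \<notin> Nc u"
    using gap_outside_neighbor g(1) y(1) u by metis
  let ?C = "Nc u - \<Union>(gaps u)"
  let ?D = "(\<lambda>c. {w', c}) ` ?C"
  have sub: "?D \<subseteq> gaps w"
  proof
    fix d assume "d \<in> ?D"
    then obtain c where c: "c \<in> Nc u" "c \<notin> \<Union>(gaps u)" "d = {w', c}" by auto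
    have eq: "Nc c = Nc u" by (rule Nc_eq_if_not_in_gap[OF u c(1,2)])
    have cw: "c \<noteq> w" using g c by auto
    have cV: "c \<in> V" using c u N_subset by auto
    have "w \<in> N c" using y eq cw by auto
    then have "c \<in> N w" using N_sym[OF cV] by simp
    moreover have "w' \<notin> N c" "w' \<noteq> c" using w' eq c by auto
    ultimately have "{c, w'} \<in> gaps w" using gapsI w' by metis
    then show "d \<in> gaps w" using c by (simp add: insert_commute)
  qed
  have "inj_on (\<lambda>c. {w', c}) ?C"
    by (auto simp: inj_on_def doubleton_eq_iff)
  then have "card ?D = card ?C" by (rule card_image)
  also have "\<dots> = k + 1 - card (\<Union>(gaps u))"
    using Union_gaps_subset[of u] card_Nc[OF u] finite_subset[OF Union_gaps_subset[of u]]
    by (subst card_Diff_subset) auto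
  finally have cD: "card ?D = k + 1 - card (\<Union>(gaps u))" .
  show "k + 1 \<le> card (\<Union>(gaps u)) + defect w"
    using card_mono[OF finite_gaps sub] cD by linarith
  assume f: "f \<in> gaps u" "\<Union>(gaps u - {f}) \<inter> f = {}" "e \<noteq> f"
  have wf: "w \<notin> f" using f g by auto
  have "z \<in> N w" if "z \<in> f" for z
  proof (rule ccontr)
    assume "z \<notin> N w"
    moreover have "z \<in> N u" using f(1) that by (auto simp: gaps_def)
    ultimately have "{w, z} \<in> gaps u" using wf that y by (intro gapsI) auto
    then show False using f(2) that wf by auto
  qed
  then have "f \<in> gaps w" using f(1) by (auto simp: gaps_def)
  moreover have "f \<notin> ?D" using w' f(1) by (auto simp: gaps_def)
  moreover have "finite ?D" by simp
  ultimately have "card (insert f ?D) \<le> defect w" "card (insert f ?D) = card ?D + 1"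
    using sub by (intro card_mono, simp, simp, simp)
  then show "k + 2 \<le> card (\<Union>(gaps u)) + defect w"
    using cD by linarith
qed

text \<open>The vertices in the two gaps qualify. Disjoint gaps cover four vertices, and the sharper
  estimate of \<open>defect_gap_vertex\<close> gives \<open>k + 2 - 4\<close>; overlapping gaps
  cover three, and the basic estimate gives \<open>k + 1 - 3\<close>.\<close>

lemma defect_two_neighbors:
  assumes u: "u \<in> V" "defect u = 2"
  shows "3 \<le> card {w \<in> N u. k \<le> defect w + 2}"
proof -
  obtain e f where ef: "gaps u = {e, f}" "e \<noteq> f"
    using u(2) by (auto simp: card_2_iff)
  then have "e \<in> gaps u" "f \<in> gaps u" by auto
  then have ce: "card e = 2" "card f = 2" "finite e" "finite f"
    by (auto simp: gaps_def intro: finite_subset[OF _ finite_N])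
  have cu: "card e + card f = card (e \<union> f) + card (e \<inter> f)"
    by (rule card_Un_Int) (use ce in auto)
  have "e \<inter> f \<noteq> e" using ef ce by (metis Int_lower2 card_subset_eq)
  then have "card (e \<inter> f) < card e" using ce by (intro psubset_card_mono) auto
  then have ge: "3 \<le> card (e \<union> f)" using cu ce by linarith
  have "e \<union> f \<subseteq> {w \<in> N u. k \<le> defect w + 2}"
  proof
    fix w assume w: "w \<in> e \<union> f"
    have "k \<le> defect w + 2"
    proof (cases "e \<inter> f = {}")
      case True
      have un: "card (\<Union>(gaps u)) = 4" using cu True ce ef by simp
      from w show ?thesis
      proof
        assume "w \<in> e"
        then have "k + 2 \<le> card (\<Union>(gaps u)) + defect w"
          using ef True by (intro defect_gap_vertex(2)[of e u w f]) (auto simp: u)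
        then show ?thesis using un by simp
      next
        assume "w \<in> f"
        then have "k + 2 \<le> card (\<Union>(gaps u)) + defect w"
          using ef True by (intro defect_gap_vertex(2)[of f u w e]) (auto simp: u)
        then show ?thesis using un by simp
      qed
    next
      case False
      then have "card (e \<inter> f) > 0" using ce by (simp add: card_gt_0_iff)
      then have "card (\<Union>(gaps u)) \<le> 3" using cu ce ef by simp
      moreover have "k + 1 \<le> card (\<Union>(gaps u)) + defect w"
        using w ef defect_gap_vertex(1)[OF _ _ u(1)] by blast
      ultimately show ?thesis by simp
    qed
    moreover have "w \<in> N u" using w ef Union_gaps_subset[of u] by auto
    ultimately show "w \<in> {w \<in> N u. k \<le> defect w + 2}" by simp
  qed
  then have "card (e \<union> f) \<le> card {w \<in> N u. k \<le> defect w + 2}"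
    by (intro card_mono) auto
  then show ?thesis using ge by simp
qed

section \<open>Blocks around vertices of defect 1\<close>

abbreviation core :: "'a \<Rightarrow> bool" where "core v \<equiv> defect v = 1"

text \<open>The vertices of the blocks, that is, of the induced copies of \<open>K\<^bsub>k+1\<^esub> - e\<close>, are exactly
  the covered ones.\<close>
definition covered :: "'a \<Rightarrow> bool" where
  "covered u \<longleftrightarrow> core u \<or> (\<exists>v \<in> N u. core v)"

lemma core_Nc:
  assumes "core v" "v \<in> V" "c \<in> Nc v" "c \<notin> \<Union>(gaps v)"
  shows "Nc c = Nc v" "gaps c = gaps v" "core c"
proof -
  show "Nc c = Nc v" by (rule Nc_eq_if_not_in_gap) fact+
  then show "gaps c = gaps v" by (simp only: gaps_eq_Nc)
  then show "core c" using assms by simp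
qed

text \<open>Missing only itself and \<open>y\<close> in \<open>Nc v\<close>, the end
  \<open>x\<close> has exactly one neighbour \<open>x'\<close> outside the block. The inner vertices
  are pairwise adjacent and not adjacent to \<open>x'\<close>, so the gaps at \<open>x\<close> are
  the \<open>k - 1\<close> pairs of \<open>x'\<close> with an inner vertex. No other neighbour of
  \<open>x'\<close> is adjacent to \<open>x\<close>, which yields \<open>k - 1\<close> gaps at
  \<open>x'\<close>.\<close>

lemma core_gap_vertex:
  assumes v: "core v" "v \<in> V" and e: "gaps v = {{x, y}}"
  obtains x' where "x' \<notin> Nc v" "x' \<in> V" "N x = insert x' (Nc v - {x, y})"
    "defect x = k - 1" "k - 1 \<le> defect x'"
proof -
  have xy: "x \<noteq> y" "x \<in> N v" "y \<in> N v" "y \<notin> N x" "x \<in> V"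
    using gapsE[of "{x, y}" v x] e by (auto simp: doubleton_eq_iff)
  obtain x' where x': "x' \<in> N x" "x' \<notin> Nc v"
    using gap_outside_neighbor[of x y v] e v by auto
  let ?C = "Nc v - {x, y}"
  have C: "Nc c = Nc v" "core c" if "c \<in> ?C" for c
    using core_Nc[OF v, of c] that e by auto
  have CV: "c \<in> V" if "c \<in> ?C" for c using that v N_subset by auto
  have "c \<in> N x" if "c \<in> ?C" for c
  proof (rule N_sym[OF CV[OF that]])
    have "x \<in> Nc c" using C(1)[OF that] xy by simp
    then show "x \<in> N c" using that by auto
  qed
  then have "insert x' ?C \<subseteq> N x" using x' by auto
  moreover have cC: "card ?C = k - 1"
    using card_Nc[OF v(2)] xy by (subst card_Diff_subset) auto
  moreover have "card (insert x' ?C) = k"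
    using x' cC k3 by (subst card_insert_disjoint) auto
  ultimately have Nx: "N x = insert x' ?C"
    using card_subset_eq[of "N x" "insert x' ?C"] card_N[OF xy(5)] by simp
  have x'V: "x' \<in> V" using x' N_subset by auto
  have nadj: "x' \<notin> N c" if "c \<in> ?C" for c using C(1)[OF that] x' by auto
  have adj: "d \<in> N c" if "c \<in> ?C" "d \<in> ?C" "c \<noteq> d" for c d using C(1)[OF that(1)] that by auto
  have "gaps x = (\<lambda>c. {x', c}) ` ?C"
  proof
    show "gaps x \<subseteq> (\<lambda>c. {x', c}) ` ?C"
    proof
      fix g assume g: "g \<in> gaps x"
      then obtain a where "a \<in> g" by (auto simp: gaps_def card_2_iff)
      then obtain b where ab: "g = {a, b}" "a \<noteq> b" "a \<in> N x" "b \<in> N x" "b \<notin> N a"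
        using gapsE[OF g] by metis
      then have "a = x' \<or> b = x'" using adj Nx by auto
      then show "g \<in> (\<lambda>c. {x', c}) ` ?C"
        using ab Nx by (auto simp: insert_commute)
    qed
    show "(\<lambda>c. {x', c}) ` ?C \<subseteq> gaps x"
    proof
      fix g assume "g \<in> (\<lambda>c. {x', c}) ` ?C"
      then obtain c where c: "c \<in> ?C" "g = {x', c}" by blast
      have "{c, x'} \<in> gaps x" using nadj[OF c(1)] c(1) x' Nx by (intro gapsI) auto
      then show "g \<in> gaps x" by (simp add: c(2) insert_commute)
    qed
  qed
  moreover have "inj_on (\<lambda>c. {x', c}) ?C" by (auto simp: inj_on_def doubleton_eq_iff)
  ultimately have dx: "defect x = k - 1" using cC by (simp add: card_image)
  have "(\<lambda>c. {x, c}) ` (N x' - {x}) \<subseteq> gaps x'"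
  proof
    fix g assume "g \<in> (\<lambda>c. {x, c}) ` (N x' - {x})"
    then obtain c where c: "c \<in> N x'" "c \<noteq> x" "g = {x, c}" by blast
    have "c \<notin> N x" using Nx nadj[of c] N_sym[OF x'V c(1)] c not_in_N[of x'] by auto
    then show "g \<in> gaps x'" using c N_sym[OF xy(5) x'(1)] by (auto intro: gapsI)
  qed
  then have "card ((\<lambda>c. {x, c}) ` (N x' - {x})) \<le> defect x'" by (intro card_mono) auto
  moreover have "card ((\<lambda>c. {x, c}) ` (N x' - {x})) = k - 1"
    using card_N[OF x'V] N_sym[OF xy(5) x'(1)]
    by (subst card_image) (auto simp: inj_on_def doubleton_eq_iff)
  ultimately show thesis using that x'(2) x'V Nx dx by simp
qed

subsection \<open>Discharging\<close>

definition mu :: real where "mu = 3 * (real k - 1) / (real k + 1)"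

text \<open>
  The amount of charge that \<open>w\<close> sends to its neighbour \<open>u\<close>. The first amount balances a
  block exactly. The second one is slightly more than the deficit of a vertex of defect 2
  requires, so that the comparison with \<open>\<mu>\<close> is strict also for \<open>k \<ge> 5\<close>; for
  \<open>k \<le> 4\<close> one has \<open>\<mu> < 2\<close> anyway.
\<close>
definition transfer :: "'a \<Rightarrow> 'a \<Rightarrow> real" where
  "transfer w u =
    (if defect u = 1 \<and> k \<le> defect w + 1 then (real k - 2) / (real k + 1)
     else if defect u = 2 \<and> k \<le> defect w + 2 \<and> 5 \<le> k then (real k - 4) / (3 * (real k + 1))
     else 0)"

definition charge :: "'a \<Rightarrow> real" where
  "charge u = real (defect u) + (\<Sum>w\<in>N u. transfer w u) - (\<Sum>w\<in>N u. transfer u w)"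

text \<open>Every transfer is counted once as sent and once as received.\<close>

lemma sum_charge: "(\<Sum>u\<in>V. charge u) = (\<Sum>u\<in>V. real (defect u))"
proof -
  have "(\<Sum>u\<in>V. \<Sum>w\<in>N u. transfer w u) = (\<Sum>w\<in>V. \<Sum>u\<in>{u \<in> V. {u, w} \<in> E}. transfer w u)"
    unfolding neighbors_def by (rule sum.swap_restrict) (rule finite_V)+
  also have "\<dots> = (\<Sum>w\<in>V. \<Sum>u\<in>N w. transfer w u)"
    by (simp add: neighbors_def insert_commute)
  finally show ?thesis
    by (simp add: charge_def sum.distrib sum_subtractf)
qed

lemma transfer_nonneg: "0 \<le> transfer w u"
  using k3 by (auto simp: transfer_def)

text \<open>Only the two ends of the block have defect large enough to send, and 1 + 2(k-2)/(k+1)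
  equals \<open>mu\<close>.\<close>

lemma charge_core:
  assumes u: "u \<in> V" "core u"
  shows "charge u = mu"
proof -
  obtain e where e: "gaps u = {e}" using u(2) by (auto simp: card_1_singleton_iff)
  then have "e \<in> gaps u" by simp
  then obtain x where "x \<in> e" by (auto simp: gaps_def card_2_iff)
  obtain y where xy: "e = {x, y}" "x \<noteq> y" "x \<in> N u" "y \<in> N u"
    by (rule gapsE[OF \<open>e \<in> gaps u\<close> \<open>x \<in> e\<close>])
  have dx: "defect x = k - 1"
    using core_gap_vertex[OF u(2,1), of x y] e xy by metis
  have dy: "defect y = k - 1"
    using core_gap_vertex[OF u(2,1), of y x] e xy by (metis insert_commute)
  have dc: "core c" if "c \<in> N u - {x, y}" for c
    using core_Nc(3)[OF u(2,1), of c] that e xy by auto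
  have "(\<Sum>w\<in>N u. transfer w u) = (\<Sum>w\<in>{x, y}. transfer w u)"
    using xy dc k3 u by (intro sum.mono_neutral_right) (auto simp: transfer_def)
  also have "\<dots> = 2 * ((real k - 2) / (real k + 1))"
    using xy dx dy u k3 by (simp add: transfer_def)
  finally have recv: "(\<Sum>w\<in>N u. transfer w u) = 2 * ((real k - 2) / (real k + 1))" .
  have "(\<Sum>w\<in>N u. transfer u w) = 0"
    using u k3 by (intro sum.neutral) (auto simp: transfer_def)
  then show ?thesis
    using recv u by (simp add: charge_def mu_def field_simps)
qed

text \<open>A neighbour of \<open>v\<close> outside its only gap would be a twin of
  \<open>v\<close>, hence core.\<close>

lemma noncore_neighbor_of_core:
  assumes v: "v \<in> V" "core v" and u: "u \<in> N v" "\<not> core u"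
  obtains y where "gaps v = {{u, y}}" "u \<noteq> y" "y \<in> N v" "y \<notin> N u"
proof -
  obtain e where e: "gaps v = {e}" using v(2) by (auto simp: card_1_singleton_iff)
  have "u \<in> e" using core_Nc(3)[OF v(2,1), of u] u e by auto
  then show thesis
    using gapsE[of e v u] e that by (metis singletonI)
qed

text \<open>Here \<open>u\<close> is an end of a block. It pays its \<open>k - 1\<close> inner
  vertices only, and (k-1) - (k-1)(k-2)/(k+1) equals \<open>mu\<close>.\<close>

lemma charge_noncore_covered:
  assumes u: "u \<in> V" "\<not> core u" and v: "v \<in> N u" "core v"
  shows "charge u = mu"
proof -
  have vV: "v \<in> V" using v N_subset by auto
  have uv: "u \<in> N v" using N_sym[OF u(1) v(1)] .
  obtain y where y: "gaps v = {{u, y}}" "u \<noteq> y" "y \<in> N v"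
    using noncore_neighbor_of_core[OF vV v(2) uv u(2)] by metis
  obtain x' where x': "x' \<notin> Nc v" "N u = insert x' (Nc v - {u, y})" "defect u = k - 1" "k - 1 \<le> defect x'"
    using core_gap_vertex[OF v(2) vV y(1)] by metis
  let ?C = "Nc v - {u, y}"
  have dc: "core c" if "c \<in> ?C" for c
    using core_Nc(3)[OF v(2) vV, of c] that y by auto
  have cC: "card ?C = k - 1"
    using card_Nc[OF vV] uv y by (subst card_Diff_subset) auto
  \<comment> \<open>The defect \<open>k - 1\<close> equals 2 only for \<open>k = 3\<close>, where
    the condition \<open>5 \<le> k\<close> disables the second transfer; the same holds for
    \<open>x'\<close> below.\<close>
  have recv: "(\<Sum>w\<in>N u. transfer w u) = 0"
    using x' k3 by (intro sum.neutral) (auto simp: transfer_def)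
  have "transfer u x' = 0"
    using x' k3 by (auto simp: transfer_def)
  then have "(\<Sum>w\<in>N u. transfer u w) = (\<Sum>w\<in>?C. transfer u w)"
    unfolding x'(2) using x'(1) by (subst sum.insert) auto
  moreover have "transfer u c = (real k - 2) / (real k + 1)" if "c \<in> ?C" for c
    using dc[OF that] x'(3) k3 by (simp add: transfer_def)
  ultimately have "(\<Sum>w\<in>N u. transfer u w) = (\<Sum>w\<in>?C. (real k - 2) / (real k + 1))"
    using sum.cong[OF refl] by metis
  then show ?thesis
    using recv cC k3 x'(3) by (simp add: charge_def mu_def field_simps)
qed

text \<open>Without core neighbours only the second transfer can leave \<open>u\<close>. Defect 2 is
  topped up by three neighbours, middle defects send nothing and exceed \<open>mu\<close> since
  \<open>mu < 3\<close>, and a defect of at least \<open>k - 2\<close> survives paying all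
  \<open>k\<close> neighbours.\<close>

lemma charge_uncovered:
  assumes u: "u \<in> V" "\<not> covered u" "0 < defect u"
  shows "mu < charge u"
proof -
  let ?s = "(real k - 4) / (3 * (real k + 1))"
  have d2: "2 \<le> defect u" using u by (auto simp: covered_def)
  have nc: "\<not> core w" if "w \<in> N u" for w using u that by (auto simp: covered_def)
  have recv: "0 \<le> (\<Sum>w\<in>N u. transfer w u)" by (intro sum_nonneg transfer_nonneg)
  have mu3: "mu < 3" by (simp add: mu_def field_simps)
  consider "k \<le> 4" | "5 \<le> k" "defect u = 2" | "5 \<le> k" "3 \<le> defect u" "defect u + 2 < k"
    | "5 \<le> k" "k \<le> defect u + 2"
    using d2 by linarith
  then show ?thesis
  proof cases
    case 1
    have "(\<Sum>w\<in>N u. transfer u w) = 0"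
      using 1 nc by (intro sum.neutral) (auto simp: transfer_def)
    moreover have "mu < 2" using 1 by (simp add: mu_def field_simps)
    ultimately show ?thesis using recv d2 by (simp add: charge_def)
  next
    case 2
    let ?W = "{w \<in> N u. k \<le> defect w + 2}"
    have give: "(\<Sum>w\<in>N u. transfer u w) = 0"
      using 2 nc by (intro sum.neutral) (auto simp: transfer_def)
    have "3 * ?s \<le> real (card ?W) * ?s"
      using defect_two_neighbors[OF u(1) 2(2)] 2(1) by (intro mult_right_mono) auto
    also have "\<dots> = (\<Sum>w\<in>?W. transfer w u)"
      using 2 by (simp add: transfer_def)
    also have "\<dots> \<le> (\<Sum>w\<in>N u. transfer w u)"
      by (intro sum_mono2) (auto simp: transfer_nonneg)
    finally have "2 + 3 * ?s \<le> charge u" using give 2 by (simp add: charge_def)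
    moreover have "mu < 2 + 3 * ?s" by (simp add: mu_def field_simps)
    ultimately show ?thesis by linarith
  next
    case 3
    have "(\<Sum>w\<in>N u. transfer u w) = 0"
      using 3 nc by (intro sum.neutral) (auto simp: transfer_def)
    then show ?thesis using 3 recv mu3 by (simp add: charge_def)
  next
    case 4
    have "(\<Sum>w\<in>N u. transfer u w) \<le> real (card (N u)) * ?s"
      using nc 4 by (intro sum_bounded_above) (auto simp: transfer_def)
    then have "real k - 2 - real k * ?s \<le> charge u"
      using 4 recv card_N[OF u(1)] by (simp add: charge_def)
    moreover have "mu < real k - 2 - real k * ?s"
    proof -
      \<comment> \<open>Over the denominator 3(k+1) the claim becomes 2k^2 - 8k + 3 > 0, which is
        linear in k once k^2 is bounded below by 5k.\<close>
      have "5 * real k \<le> real k * real k" using 4 by (intro mult_right_mono) auto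
      moreover have "3 * (real k - 2) * (real k + 1) - real k * (real k - 4) - 9 * (real k - 1)
          = 2 * (real k * real k) - 8 * real k + 3"
        by (simp add: algebra_simps)
      ultimately have "9 * (real k - 1) < 3 * (real k - 2) * (real k + 1) - real k * (real k - 4)"
        using 4 by linarith
      then have "9 * (real k - 1) / (3 * (real k + 1))
          < (3 * (real k - 2) * (real k + 1) - real k * (real k - 4)) / (3 * (real k + 1))"
        by (intro divide_strict_right_mono) auto
      moreover have "(3 * (real k - 2) * (real k + 1) - real k * (real k - 4)) / (3 * (real k + 1))
          = real k - 2 - real k * ?s"
        by (simp add: field_simps)
      moreover have "mu = 9 * (real k - 1) / (3 * (real k + 1))" by (simp add: mu_def field_simps)
      ultimately show ?thesis by linarith
    qed
    ultimately show ?thesis by linarith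
  qed
qed

lemma sum_defect_bound:
  assumes pos: "\<And>u. u \<in> V \<Longrightarrow> 0 < defect u"
  shows "real (card V) * mu \<le> (\<Sum>u\<in>V. real (defect u))"
    and "(\<Sum>u\<in>V. real (defect u)) = real (card V) * mu \<longleftrightarrow> (\<forall>u\<in>V. covered u)"
proof -
  have eq: "charge u = mu" if "u \<in> V" "covered u" for u
    using that charge_core charge_noncore_covered by (auto simp: covered_def)
  have gt: "mu < charge u" if "u \<in> V" "\<not> covered u" for u
    using charge_uncovered that pos by blast
  have ge: "mu \<le> charge u" if "u \<in> V" for u
    using eq gt that by force
  have "(\<Sum>u\<in>V. mu) \<le> (\<Sum>u\<in>V. charge u)" by (rule sum_mono[OF ge])
  then show "real (card V) * mu \<le> (\<Sum>u\<in>V. real (defect u))" by (simp add: sum_charge)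
  show "(\<Sum>u\<in>V. real (defect u)) = real (card V) * mu \<longleftrightarrow> (\<forall>u\<in>V. covered u)"
  proof
    assume "\<forall>u\<in>V. covered u"
    then have "(\<Sum>u\<in>V. charge u) = (\<Sum>u\<in>V. mu)" using eq by (intro sum.cong) auto
    then show "(\<Sum>u\<in>V. real (defect u)) = real (card V) * mu" by (simp add: sum_charge)
  next
    assume *: "(\<Sum>u\<in>V. real (defect u)) = real (card V) * mu"
    show "\<forall>u\<in>V. covered u"
    proof (rule ccontr)
      assume "\<not> (\<forall>u\<in>V. covered u)"
      then have "\<exists>u\<in>V. mu < charge u" using gt by blast
      then have "(\<Sum>u\<in>V. mu) < (\<Sum>u\<in>V. charge u)"
        using ge finite_V by (intro sum_strict_mono_ex1) auto
      then show False using * by (simp add: sum_charge)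
    qed
  qed
qed

section \<open>From defects to the clustering coefficient\<close>

lemma clustering_defect:
  assumes "V \<noteq> {}"
  shows "clustering V E = 1 - (\<Sum>u\<in>V. real (defect u)) / (real (card V) * real (k choose 2))"
proof -
  have "real (card V) \<noteq> 0" using assms finite_V by simp
  then show ?thesis
    by (simp add: clustering_def local_clustering_defect sum_subtractf diff_divide_distrib
        sum_divide_distrib mult.commute)
qed

text \<open>This is the origin of the constant in the theorem: an average defect \<open>mu\<close>
  lowers the clustering coefficient by \<open>mu\<close> divided by
  \<open>k choose 2\<close>.\<close>

lemma mu_choose: "mu = 6 / (real k * (real k + 1)) * real (k choose 2)"
proof -
  have "real (k choose 2) = real k * (real k - 1) / 2"
    using k3 by (simp add: choose_two real_of_nat_div)
  then show ?thesis using k3 by (simp only:) (simp add: mu_def field_simps)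
qed

lemma clustering_bound:
  assumes ne: "V \<noteq> {}" and pos: "\<And>u. u \<in> V \<Longrightarrow> 0 < defect u"
  shows "clustering V E \<le> 1 - 6 / (real k * (real k + 1))"
    and "clustering V E = 1 - 6 / (real k * (real k + 1)) \<longleftrightarrow> (\<forall>u\<in>V. covered u)"
proof -
  let ?n = "real (card V)" and ?c = "real (k choose 2)" and ?r = "6 / (real k * (real k + 1))"
    and ?D = "\<Sum>u\<in>V. real (defect u)"
  have n: "0 < ?n * ?c" using ne finite_V k3 by (simp add: card_gt_0_iff)
  have "?n * mu = ?r * (?n * ?c)" by (simp add: mu_choose)
  then have "?r \<le> ?D / (?n * ?c)" "?r = ?D / (?n * ?c) \<longleftrightarrow> (\<forall>u\<in>V. covered u)"
    using sum_defect_bound[OF pos] n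
    by (simp_all only: pos_le_divide_eq) (metis nonzero_eq_divide_eq less_irrefl)
  then show "clustering V E \<le> 1 - ?r" "clustering V E = 1 - ?r \<longleftrightarrow> (\<forall>u\<in>V. covered u)"
    unfolding clustering_defect[OF ne] by auto
qed

section \<open>Consequences of connectedness\<close>

lemma closed_eq_V:
  assumes "connected_graph V E" "U \<subseteq> V" "u \<in> U" "\<And>x. x \<in> U \<Longrightarrow> N x \<subseteq> U"
  shows "U = V"
proof -
  have "v \<in> U" if "v \<in> V" for v
  proof -
    have "(u, v) \<in> {(x, y). x \<in> V \<and> y \<in> V \<and> {x, y} \<in> E}\<^sup>*"
      using assms that by (auto simp: connected_graph_def)
    then show ?thesis
      by (induction rule: rtrancl_induct) (use assms in \<open>auto simp: neighbors_def\<close>)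
  qed
  then show ?thesis using assms by auto
qed

text \<open>Without gaps all vertices of \<open>Nc u\<close> are twins, so \<open>Nc u\<close> is
  closed under neighbours and would be the whole graph, with only \<open>k + 1\<close>
  vertices.\<close>

lemma defect_pos:
  assumes "connected_graph V E" "k + 2 \<le> card V" "u \<in> V"
  shows "0 < defect u"
proof (rule ccontr)
  assume "\<not> 0 < defect u"
  then have g: "gaps u = {}" by simp
  have "Nc u = V"
  proof (rule closed_eq_V[OF assms(1), of _ u])
    fix x assume "x \<in> Nc u"
    then have "Nc x = Nc u" by (intro Nc_eq_if_not_in_gap) (simp_all add: assms g)
    then show "N x \<subseteq> Nc u" by (metis subset_insertI)
  qed (use assms N_subset in auto)
  then show False using card_Nc[OF assms(3)] assms by simp
qed

subsection \<open>The cycle of blocks\<close>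

text \<open>For an end \<open>x\<close> of a block these are its \<open>k - 1\<close> inner
  vertices; both ends give the same set.\<close>

definition C :: "'a \<Rightarrow> 'a set" where "C x = {c \<in> N x. core c}"

text \<open>The witness \<open>y\<close> is the other end of the block of \<open>x\<close>, and
  \<open>z\<close> is the neighbour of \<open>x\<close> outside it. All facts sit under one
  existential so that \<open>p\<close> and \<open>q\<close> can be chosen together later.\<close>

lemma noncore_structure:
  assumes x: "x \<in> V" "\<not> core x" "covered x"
  shows "\<exists>y z. N x = insert z (C x) \<and> z \<in> V \<and> \<not> core z \<and> y \<in> V \<and> \<not> core y \<and> y \<noteq> x \<and>
    C y = C x \<and> card (C x) = k - 1 \<and> (\<forall>c \<in> C x. N c = insert x (insert y (C x)) - {c})"
proof -
  obtain v where v: "v \<in> N x" "core v" using x by (auto simp: covered_def)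
  have vV: "v \<in> V" using v N_subset by auto
  have xv: "x \<in> N v" using N_sym[OF x(1) v(1)] .
  obtain y where y: "gaps v = {{x, y}}" "x \<noteq> y" "y \<in> N v"
    using noncore_neighbor_of_core[OF vV v(2) xv x(2)] by metis
  obtain z where z: "z \<notin> Nc v" "z \<in> V" "N x = insert z (Nc v - {x, y})" "k - 1 \<le> defect z"
    using core_gap_vertex[OF v(2) vV y(1)] by metis
  have y': "gaps v = {{y, x}}" using y by (simp add: insert_commute)
  obtain z' where z': "N y = insert z' (Nc v - {y, x})" "defect y = k - 1" "k - 1 \<le> defect z'"
    using core_gap_vertex[OF v(2) vV y'] by metis
  have nc: "\<not> core z" "\<not> core z'" "\<not> core y" using z z' k3 by auto
  have dc: "Nc c = Nc v" "core c" if "c \<in> Nc v - {x, y}" for c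
    using core_Nc[OF v(2) vV, of c] that y by auto
  have Cx: "C x = Nc v - {x, y}" using z(3) nc dc(2) by (auto simp: C_def)
  have "C y = Nc v - {x, y}" using z'(1) nc dc(2) by (auto simp: C_def)
  moreover have "card (Nc v - {x, y}) = k - 1"
    using card_Nc[OF vV] xv y by (subst card_Diff_subset) auto
  moreover have "N c = insert x (insert y (C x)) - {c}" if "c \<in> C x" for c
  proof -
    have "Nc c - {c} = Nc v - {c}" using dc(1)[of c] that Cx by simp
    moreover have "Nc v = insert x (insert y (C x))" using xv y Cx by auto
    ultimately show ?thesis by simp
  qed
  moreover have "y \<in> V" using y N_subset by auto
  ultimately show ?thesis
    using z nc y Cx by metis
qed

text \<open>On the set \<open>P\<close> of block ends, \<open>p\<close> and \<open>q\<close> are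
  involutions without fixed points. \<open>two_involutions_cycle\<close> orders blocks cyclically,
  with entry ends \<open>x i\<close> and exit ends \<open>p (x i)\<close>.\<close>

lemma covered_graph_iso:
  assumes conn: "connected_graph V E" and ne: "V \<noteq> {}" and cov: "\<forall>u\<in>V. covered u"
  obtains r where "card V = (k + 1) * r" "graph_iso V E (Gkl_V k r) (Gkl_E k r)"
proof -
  define P where "P = {x \<in> V. \<not> core x}"
  have "\<forall>x\<in>P. \<exists>y z. N x = insert z (C x) \<and> z \<in> V \<and> \<not> core z \<and> y \<in> V \<and> \<not> core y \<and> y \<noteq> x \<and>
    C y = C x \<and> card (C x) = k - 1 \<and> (\<forall>c \<in> C x. N c = insert x (insert y (C x)) - {c})"
    using noncore_structure cov by (simp add: P_def)
  then obtain p q where pq: "\<forall>x\<in>P. N x = insert (q x) (C x) \<and> q x \<in> V \<and> \<not> core (q x) \<and>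
      p x \<in> V \<and> \<not> core (p x) \<and> p x \<noteq> x \<and> C (p x) = C x \<and> card (C x) = k - 1 \<and>
      (\<forall>c \<in> C x. N c = insert x (insert (p x) (C x)) - {c})"
    by metis
  have PV: "x \<in> V" and Pc: "\<not> core x" if "x \<in> P" for x using that by (auto simp: P_def)
  have NP: "N x = insert (q x) (C x)" if "x \<in> P" for x using pq that by simp
  have NC: "N c = insert x (insert (p x) (C x)) - {c}" if "x \<in> P" "c \<in> C x" for x c
    using pq that by simp
  have Cp: "C (p x) = C x" if "x \<in> P" for x using pq that by simp
  have cardC: "card (C x) = k - 1" if "x \<in> P" for x using pq that by simp
  have Ccore: "core c" "c \<in> V" if "c \<in> C x" for x c using that N_subset by (auto simp: C_def)
  have q1: "q x \<in> P" and p1: "p x \<in> P" and p3: "p x \<noteq> x" if "x \<in> P" for x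
    using bspec[OF pq that] by (simp_all add: P_def)
  have q_adj: "q x \<in> N x" if "x \<in> P" for x using NP[OF that] by (metis insertI1)
  have q3: "q x \<noteq> x" if "x \<in> P" for x using q_adj[OF that] by (metis not_in_N)
  have q_unique: "w = q x" if "x \<in> P" "w \<in> P" "w \<in> N x" for x w
    using NP[OF that(1)] that(3) Ccore(1)[of w x] Pc[OF that(2)] by blast
  have q2: "q (q x) = x" if "x \<in> P" for x
    using q_unique[OF q1[OF that] that N_sym[OF PV[OF that] q_adj[OF that]]] by simp
  \<comment> \<open>An inner vertex sees just two ends. This makes \<open>p\<close> an involution
    and later keeps distinct blocks disjoint.\<close>
  have shared: "z = x \<or> z = p x" if "x \<in> P" "z \<in> P" "c \<in> C x" "c \<in> C z" for x z c
  proof -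
    have "c \<in> N z" using that by (simp add: C_def)
    then have "z \<in> N c" using N_sym PV that by blast
    then have "z \<in> insert x (insert (p x) (C x))" using NC that by blast
    then show ?thesis using Ccore(1)[of z x] Pc[OF that(2)] by auto
  qed
  have p2: "p (p x) = x" if "x \<in> P" for x
  proof -
    have "C x \<noteq> {}" using cardC[OF that] k3 by auto
    then obtain c where c: "c \<in> C x" by blast
    then show ?thesis using shared[of "p x" x c] that p1 p3 Cp by metis
  qed
  have finP: "finite P" using finite_V by (simp add: P_def)
  \<comment> \<open>Covering provides a core vertex; a vertex of its gap has defect
    \<open>k - 1\<close>, which exceeds 1.\<close>
  obtain x0 where x0: "x0 \<in> P"
  proof -
    obtain u where u: "u \<in> V" using ne by auto
    then obtain v where v: "v \<in> V" "core v" using cov N_subset by (fastforce simp: covered_def)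
    then obtain e where e: "gaps v = {e}" by (auto simp: card_1_singleton_iff)
    then have "e \<in> gaps v" by simp
    then obtain w where w: "w \<in> e" by (auto simp: gaps_def card_2_iff)
    obtain w' where w': "e = {w, w'}" "w \<in> V"
      using gapsE[of e v w] e w by (metis singletonI)
    have "defect w = k - 1" using core_gap_vertex[OF v(2,1), of w w'] e w' by metis
    then show thesis using that[of w] w' k3 by (auto simp: P_def)
  qed
  obtain x r where r: "0 < r" and xP: "\<And>i. x i \<in> P"
    and next_x: "\<And>i. i < r \<Longrightarrow> q (p (x i)) = x (Suc i mod r)"
    and inj: "inj_on x {..<r}" and px: "\<And>i j. p (x i) \<noteq> x j"
    using two_involutions_cycle[OF finP x0 p1 p2 p3 q1 q2 q3] by metis
  \<comment> \<open>Inner vertices are interchangeable, so any numbering by \<open>2..k\<close>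
    works; labels 0 and 1 are kept for entry and exit, as in \<open>Gkl_E\<close>.\<close>
  have "\<forall>z\<in>P. \<exists>h. bij_betw h {2..k} (C z)"
  proof
    fix z assume "z \<in> P"
    then have "card {2..k} = card (C z)" using cardC k3 by simp
    moreover have "finite (C z)" by (simp add: C_def)
    ultimately show "\<exists>h. bij_betw h {2..k} (C z)" by (intro finite_same_card_bij) auto
  qed
  then obtain h where h: "\<And>z. z \<in> P \<Longrightarrow> bij_betw (h z) {2..k} (C z)" by metis
  define g where "g = (\<lambda>(i, a). if a = 0 then x i else if a = 1 then p (x i) else h (x i) a)"
  have g0: "g (i, 0) = x i" and g1: "g (i, 1) = p (x i)" for i by (simp_all add: g_def)
  have gC: "g (i, a) \<in> C (x i)" if "2 \<le> a" "a \<le> k" for i a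
    using bij_betwE[OF h[OF xP[of i]]] that by (simp add: g_def)
  have gP: "g (i, a) \<in> P" if "a < 2" for i a
    using that xP p1 by (auto simp: g_def)
  have small: "a = 0 \<or> a = 1" if "a < 2" for a :: nat using that by auto
  have gV: "g s \<in> V" if s: "s \<in> Gkl_V k r" for s
  proof -
    obtain i a where ia: "s = (i, a)" "a \<le> k" using s by (auto simp: Gkl_V_def)
    show ?thesis
      using ia gC[of a i] gP[of a i] PV[of "g (i, a)"] Ccore(2)[of "g (i, a)" "x i"]
      by (cases "a < 2") auto
  qed
  have block: "g ` ({i} \<times> {0..k}) = insert (x i) (insert (p (x i)) (C (x i)))" for i
  proof -
    have "{0..k} = insert 0 (insert 1 {2..k})" using k3 by auto
    then have "g ` ({i} \<times> {0..k}) = insert (g (i, 0)) (insert (g (i, 1)) ((\<lambda>a. g (i, a)) ` {2..k}))"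
      by auto
    also have "(\<lambda>a. g (i, a)) ` {2..k} = h (x i) ` {2..k}"
      by (intro image_cong) (auto simp: g_def)
    also have "\<dots> = C (x i)" using h[OF xP] by (rule bij_betw_imp_surj_on)
    finally show ?thesis by (simp only: g0 g1)
  qed
  have g_inj: "i = j \<and> a = b"
    if eq: "g (i, a) = g (j, b)" and b: "i < r" "j < r" "a \<le> k" "b \<le> k" for i j a b
  \<comment> \<open>Labels below 2 give ends, which are not core, and the others give core vertices,
    so mixed cases clash. Two ends are separated by \<open>px\<close>, two inner vertices by
    \<open>shared\<close>.\<close>
  proof (cases "a < 2"; cases "b < 2")
    assume ab: "a < 2" "b < 2"
    have "p (x i) = p (x j) \<Longrightarrow> x i = x j" using p2 xP by metis
    then have "x i = x j \<and> a = b"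
      using small[OF ab(1)] small[OF ab(2)] eq px[of i j] px[of j i] by (auto simp: g0 g1 simp del: One_nat_def)
    then show ?thesis using inj b by (auto dest: inj_onD)
  next
    assume "a < 2" "\<not> b < 2"
    then show ?thesis using eq gP[of a i] gC[of b j] b Ccore Pc by (metis not_less)
  next
    assume "\<not> a < 2" "b < 2"
    then show ?thesis using eq gP[of b j] gC[of a i] b Ccore Pc by (metis not_less)
  next
    assume ab: "\<not> a < 2" "\<not> b < 2"
    then have "g (i, a) \<in> C (x i)" "g (i, a) \<in> C (x j)" using gC[of a i] gC[of b j] eq b by simp_all
    then have "x j = x i" using shared xP px by metis
    then have ij: "i = j" using inj b by (auto dest: inj_onD)
    then have "h (x i) a = h (x i) b" using eq ab by (auto simp: g_def split: if_splits)
    then show ?thesis using ij bij_betw_imp_inj_on[OF h[OF xP[of i]]] ab b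
      by (auto dest: inj_onD)
  qed
  have prev: "\<exists>m<r. x i = q (p (x m)) \<and> i = Suc m mod r" if "i < r" for i
  proof (cases i)
    case 0
    then show ?thesis using r next_x[of "r - 1"] by (intro exI[of _ "r - 1"]) auto
  next
    case (Suc m)
    then show ?thesis using that next_x[of m] by (intro exI[of _ m]) auto
  qed
  \<comment> \<open>Backwards along the cycle: the edge leaving block \<open>i\<close> at its entry
    leads to the exit of the preceding block.\<close>
  have qx: "\<exists>m<r. q (x i) = p (x m)" if "i < r" for i
    using prev[OF that] q2 p1 xP by metis
  have N_big: "N (g (i, a)) = g ` ({i} \<times> {0..k}) - {g (i, a)}" if "2 \<le> a" "a \<le> k" for i a
    unfolding block using NC[OF xP gC[OF that]] .
  \<comment> \<open>The blocks on the cycle are closed under neighbours, so connectedness leaves no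
    room for others.\<close>
  have image_V: "g ` Gkl_V k r = V"
  proof (rule closed_eq_V[OF conn])
    show "g ` Gkl_V k r \<subseteq> V" using gV by auto
    show "x 0 \<in> g ` Gkl_V k r" using r g0[of 0] by (force simp: Gkl_V_def)
    have sub: "insert (x i) (insert (p (x i)) (C (x i))) \<subseteq> g ` Gkl_V k r" if "i < r" for i
      unfolding block[symmetric] using that by (auto simp: Gkl_V_def)
    fix u assume "u \<in> g ` Gkl_V k r"
    then obtain i a where ia: "u = g (i, a)" "i < r" "a \<le> k" by (auto simp: Gkl_V_def)
    consider "a = 0" | "a = 1" | "2 \<le> a" by linarith
    then show "N u \<subseteq> g ` Gkl_V k r"
    proof cases
      case 1
      then have "N u = insert (q (x i)) (C (x i))" using ia g0 NP xP by metis
      moreover obtain m where "m < r" "q (x i) = p (x m)" using qx ia by metis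
      ultimately show ?thesis using sub[of m] sub[OF ia(2)] by auto
    next
      case 2
      then have "N u = insert (q (p (x i))) (C (x i))" using ia g1 NP xP p1 Cp by metis
      then show ?thesis using next_x[OF ia(2)] sub[of "Suc i mod r"] r sub[OF ia(2)] by auto
    next
      case 3
      then show ?thesis using N_big[of a i] ia block[of i] sub[OF ia(2)] by auto
    qed
  qed
  have bij: "bij_betw g (Gkl_V k r) V"
    unfolding bij_betw_def using image_V g_inj by (auto simp: inj_on_def Gkl_V_def)
  have big: "g (j, b) \<in> N (g (i, a)) \<longleftrightarrow> i = j \<and> a \<noteq> b"
    if "i < r" "j < r" "a \<le> k" "b \<le> k" "2 \<le> a" for i j a b
    using N_big[of a i] that g_inj[of j b i a] g_inj[of j b i] by auto
  have adj: "g (j, b) \<in> N (g (i, a)) \<longleftrightarrow> {(i, a), (j, b)} \<in> Gkl_E k r"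
    if b: "i < r" "j < r" "a \<le> k" "b \<le> k" for i j a b
  proof -
    consider "2 \<le> a" | "2 \<le> b" | "a < 2" "b < 2" by linarith
    then show ?thesis
    proof cases
      case 1
      then show ?thesis using big[OF b 1] Gkl_E_iff[OF b] by (auto simp: doubleton_eq_iff)
    next
      case 2
      have "g (j, b) \<in> N (g (i, a)) \<longleftrightarrow> g (i, a) \<in> N (g (j, b))"
        using N_sym gV[of "(i, a)"] gV[of "(j, b)"] b by (auto simp: Gkl_V_def)
      then show ?thesis
        using big[of j i b a] b 2 Gkl_E_iff[OF b] by (auto simp: doubleton_eq_iff)
    next
      case 3
      \<comment> \<open>Between ends adjacency means being exchanged by \<open>q\<close>. Since no
        \<open>p (x m)\<close> lies on the walk, \<open>q\<close> pairs entries with exits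
        only.\<close>
      have *: "g (j, b) \<in> N (g (i, a)) \<longleftrightarrow> g (j, b) = q (g (i, a))"
        using q_unique q_adj gP 3 by metis
      have x_eq: "x m = x m' \<longleftrightarrow> m = m'" if "m < r" "m' < r" for m m'
        using inj that by (auto dest: inj_onD)
      have q_swap: "y = q z \<longleftrightarrow> z = q y" if "y \<in> P" "z \<in> P" for y z
        using q2 that by metis
      have "x j \<noteq> q (x i)" using qx[OF b(1)] px by metis
      moreover have "p (x j) \<noteq> q (p (x i))" using next_x[OF b(1)] px by metis
      moreover have "x j = q (p (x i)) \<longleftrightarrow> j = Suc i mod r"
        using next_x[OF b(1)] x_eq[of j "Suc i mod r"] b by simp
      moreover have "p (x j) = q (x i) \<longleftrightarrow> i = Suc j mod r"
        using next_x[OF b(2)] x_eq[of i "Suc j mod r"] b q_swap[OF p1[OF xP] xP] by simp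
      ultimately show ?thesis
        unfolding * Gkl_E_iff[OF b] using small[OF 3(1)] small[OF 3(2)]
        by (elim disjE) (simp_all add: g0 g1 doubleton_eq_iff del: One_nat_def)
    qed
  qed
  have "graph_iso V E (Gkl_V k r) (Gkl_E k r)"
  proof (rule graph_iso_inv[OF bij])
    fix s t assume st: "s \<in> Gkl_V k r" "t \<in> Gkl_V k r"
    then show "{g s, g t} \<in> E \<longleftrightarrow> {s, t} \<in> Gkl_E k r"
      unfolding edge_iff_N[OF gV[OF st(2)]]
      using adj by (cases s; cases t) (simp add: Gkl_V_def)
  qed
  moreover have "card V = (k + 1) * r"
    using bij_betw_same_card[OF bij] by (simp add: Gkl_V_def card_cartesian_product mult.commute)
  ultimately show thesis using that by blast
qed

section \<open>The extremal graph attains the bound\<close>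

text \<open>A vertex labelled \<open>(i, a)\<close> with \<open>2 \<le> a\<close> has the pair of
  ends as its only gap, and the ends are adjacent to \<open>(i, 2)\<close>.\<close>

lemma iso_Gkl_covered:
  assumes iso: "graph_iso V E (Gkl_V k l) (Gkl_E k l)" and l: "2 \<le> l" and u: "u \<in> V"
  shows "covered u"
proof -
  obtain f where f: "bij_betw f V (Gkl_V k l)"
    and fE: "\<And>u v. u \<in> V \<Longrightarrow> v \<in> V \<Longrightarrow> {u, v} \<in> E \<longleftrightarrow> {f u, f v} \<in> Gkl_E k l"
    using iso by (auto simp: graph_iso_def)
  have range: "f v \<in> Gkl_V k l" if "v \<in> V" for v using f that by (auto dest: bij_betwE)
  have surj: "\<exists>v\<in>V. f v = s" if "s \<in> Gkl_V k l" for s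
    using f that by (metis bij_betw_imp_surj_on imageE)
  have core: "core v" if v: "v \<in> V" "f v = (i, a)" "2 \<le> a" for v i a
  proof -
    have ia: "i < l" "a \<le> k" using range[OF v(1)] v by (auto simp: Gkl_V_def)
    obtain x y where xy: "x \<in> V" "f x = (i, 0)" "y \<in> V" "f y = (i, 1)"
      using surj[of "(i, 0)"] surj[of "(i, 1)"] ia k3 by (auto simp: Gkl_V_def)
    have N: "w \<in> N v \<longleftrightarrow> (\<exists>b. f w = (i, b) \<and> b \<noteq> a)" if w: "w \<in> V" for w
    proof -
      obtain j b where jb: "f w = (j, b)" "j < l" "b \<le> k" using range[OF w] by (auto simp: Gkl_V_def)
      then show ?thesis
        using fE[OF v(1) w] edge_iff_N[OF w, of v] Gkl_E_iff[of i l j a k b] v ia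
        by (auto simp: doubleton_eq_iff)
    qed
    \<comment> \<open>For \<open>l = 1\<close> the connecting edge would join the two ends of the
      single block and close its gap.\<close>
    have neq: "Suc i mod l \<noteq> i" using ia l by (cases "Suc i = l") auto
    have "gaps v = {{x, y}}"
    proof
      have "y \<notin> N x"
        using fE[OF xy(1,3)] edge_iff_N[OF xy(3), of x] Gkl_E_iff[of i l i 0 k 1] xy ia neq k3 by auto
      then have "{x, y} \<in> gaps v" using N xy v(3) by (intro gapsI) auto
      then show "{{x, y}} \<subseteq> gaps v" by simp
      show "gaps v \<subseteq> {{x, y}}"
      proof
        fix e assume e: "e \<in> gaps v"
        then obtain s where "s \<in> e" by (auto simp: gaps_def card_2_iff)
        then obtain t where st: "e = {s, t}" "s \<noteq> t" "s \<in> N v" "t \<in> N v" "t \<notin> N s" "s \<in> V" "t \<in> V"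
          using gapsE[OF e] by metis
        then obtain b c where bc: "f s = (i, b)" "f t = (i, c)" using N by metis
        then have bk: "b \<le> k" "c \<le> k" using range[of s] range[of t] st by (auto simp: Gkl_V_def)
        have f_eq: "f s' = f t' \<longleftrightarrow> s' = t'" if "s' \<in> V" "t' \<in> V" for s' t'
          using inj_on_eq_iff[OF bij_betw_imp_inj_on[OF f] that] .
        have "b \<noteq> c" using bc st f_eq[of s t] by auto
        then have "{b, c} = {0, 1}"
          using fE[OF st(6,7)] edge_iff_N[OF st(7), of s] st(5) bc Gkl_E_iff[OF ia(1) ia(1) bk] by auto
        then have "f s = f x \<and> f t = f y \<or> f s = f y \<and> f t = f x"
          using bc xy by (auto simp: doubleton_eq_iff)
        then have "s = x \<and> t = y \<or> s = y \<and> t = x"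
          using f_eq st(6,7) xy(1,3) by simp
        then show "e \<in> {{x, y}}" using st by auto
      qed
    qed
    then show ?thesis by simp
  qed
  obtain i a where ia: "f u = (i, a)" "i < l" "a \<le> k" using range[OF u] by (auto simp: Gkl_V_def)
  show ?thesis
  proof (cases "2 \<le> a")
    case True
    then show ?thesis using core[OF u ia(1)] by (simp add: covered_def)
  next
    case False
    obtain v where v: "v \<in> V" "f v = (i, 2)" using surj[of "(i, 2)"] ia k3 by (auto simp: Gkl_V_def)
    have "v \<in> N u"
      using fE[OF u v(1)] edge_iff_N[OF v(1), of u] Gkl_E_iff[of i l i a k 2] v ia k3 False
      by (auto simp: doubleton_eq_iff)
    then show ?thesis using core[OF v] by (auto simp: covered_def)
  qed
qed

end

theorem theorem1:
  fixes V :: "'a set" and E :: "'a set set" and k n :: nat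
  assumes "k \<ge> 3" and "n \<ge> k + 2"
    and "simple_graph V E" and "connected_graph V E" and "regular V E k"
    and "card V = n"
  shows "clustering V E \<le> 1 - 6 / (real k * (real k + 1))
         \<and> (clustering V E = 1 - 6 / (real k * (real k + 1)) \<longleftrightarrow>
              ((k + 1) dvd n \<and> graph_iso V E (Gkl_V k (n div (k + 1))) (Gkl_E k (n div (k + 1)))))"
proof -
  interpret regular_graph V E k
    using assms by unfold_locales auto
  have ne: "V \<noteq> {}" using assms by auto
  have pos: "0 < defect u" if "u \<in> V" for u
    using defect_pos that assms by simp
  have "(\<forall>u\<in>V. covered u) \<longleftrightarrow>
    (k + 1) dvd n \<and> graph_iso V E (Gkl_V k (n div (k + 1))) (Gkl_E k (n div (k + 1)))"
  proof
    assume "\<forall>u\<in>V. covered u"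
    then obtain r where "n = (k + 1) * r" "graph_iso V E (Gkl_V k r) (Gkl_E k r)"
      using covered_graph_iso[OF assms(4) ne] assms(6) by metis
    then show "(k + 1) dvd n \<and> graph_iso V E (Gkl_V k (n div (k + 1))) (Gkl_E k (n div (k + 1)))"
      by (metis dvd_triv_left nonzero_mult_div_cancel_left add_is_0 one_neq_zero)
  next
    assume *: "(k + 1) dvd n \<and> graph_iso V E (Gkl_V k (n div (k + 1))) (Gkl_E k (n div (k + 1)))"
    then obtain l where l: "n = (k + 1) * l" by auto
    \<comment> \<open>The order exceeds that of one block, so there are at least two.\<close>
    have "k + 1 < n" using assms(2) by simp
    then have "(k + 1) * 1 < (k + 1) * l" unfolding l mult_1_right .
    then have "1 < l" by (metis mult_less_cancel1)
    then have "2 \<le> n div (k + 1)" by (subst l, subst nonzero_mult_div_cancel_left) auto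
    then show "\<forall>u\<in>V. covered u" using iso_Gkl_covered * by blast
  qed
  then show ?thesis using clustering_bound[OF ne pos] by simp
qed

end
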